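(* Let $(A_1,B_1),\dots,(A_m,B_m)$ be pairs of non-trivial (i.e. non-zero) subspaces of a finite-dimensional real vector space. Write $a_i=\dim A_i$ and $b_i=\dim B_i$ for $1\le i\le m$. Suppose that (i) $\dim(A_i\cap B_i)=0$ for $1\le i\le m$, (ii) $\dim(A_i\cap B_j)>0$ for $1\le i<j\le m$, and (iii) $a_1\le a_2\le\dots\le a_m$ and $b_1\ge b_2\ge\dots\ge b_m$. Then $$\sum_{i=1}^m \frac{1}{\binom{a_i+b_i}{a_i}}\le 1.$$ *)

theory Defs
  imports Complex_Main
begin

end

theory Submission
  imports Defs "HOL-Library.Function_Algebras" "Jordan_Normal_Form.Determinant"
begin

text \<open>
  The proof counts in the exterior algebra of \<open>V\<close>, averaged over the quotients of \<open>V\<close> by the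
  coordinate subspaces of one generic basis \<open>E\<close>. Let \<open>N = dim V\<close>, and choose \<open>E\<close> so that the
  span of any \<open>N - (a\<^sub>i + b\<^sub>i)\<close> of its vectors meets \<open>A\<^sub>i + B\<^sub>i\<close> only in \<open>0\<close>
  (\<open>exists_generic_basis\<close>). Let \<open>\<alpha>\<^sub>i\<close> be the wedge of a basis of \<open>A\<^sub>i\<close>, and let \<open>I\<^sub>k\<close> be the
  right ideal of the exterior algebra that \<open>\<alpha>\<^sub>1, \<dots>, \<alpha>\<^sub>k\<close> generate. For \<open>S \<subseteq> E\<close> let \<open>rk a S\<close> be
  the dimension of the image of the degree-\<open>a\<close> part of \<open>I\<^sub>k\<close> in \<open>\<Lambda>\<^sup>a(V/\<langle>S\<rangle>)\<close>. For \<open>a + b \<le> N\<close>,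
  let the density of \<open>I\<^sub>k\<close> at \<open>(a, b)\<close> be the average of \<open>rk a S / (a + b choose a)\<close> over all \<open>S\<close>
  with \<open>N - (a + b)\<close> elements; then \<open>V/\<langle>S\<rangle>\<close> has dimension \<open>a + b\<close>, so the density is at most \<open>1\<close>.

  Two inequalities of local LYM type make the density grow when \<open>b\<close> decreases and when \<open>a\<close>
  increases. For the first, choose a basis of the space that defines \<open>rk a S\<close> among coordinate
  functionals, which are indexed by subsets of \<open>E\<close>, and count how many of them survive when a
  further \<open>v \<in> E\<close> is divided out (\<open>rk_insert_lower_bound\<close>). The second follows from the first and
  from the effect of wedging with \<open>v\<close> (\<open>rk_insert_add_le\<close>).

  The hypotheses on the pairs enter when \<open>\<alpha>\<^sub>k\<close> is added to \<open>I\<^bsub>k-1\<^esub>\<close>. In degree \<open>a\<^sub>k\<close> and modulo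
  any \<open>S\<close> of size \<open>N - (a\<^sub>k + b\<^sub>k)\<close>, wedging with a basis of \<open>B\<^sub>k\<close> is a functional. It kills
  \<open>I\<^bsub>k-1\<^esub>\<close>, because \<open>A\<^sub>i\<close> meets \<open>B\<^sub>k\<close> for \<open>i < k\<close>; it does not kill \<open>\<alpha>\<^sub>k\<close>, because \<open>A\<^sub>k\<close>, \<open>B\<^sub>k\<close>
  and \<open>S\<close> together span \<open>V\<close>. So every \<open>rk a\<^sub>k S\<close> goes up by at least one and the density at
  \<open>(a\<^sub>k, b\<^sub>k)\<close> by at least \<open>1 / (a\<^sub>k + b\<^sub>k choose a\<^sub>k)\<close>. Since \<open>a\<^sub>i\<close> increases and \<open>b\<^sub>i\<close>
  decreases, the point \<open>(a\<^sub>i, b\<^sub>i)\<close> moves only in directions in which the density grows. Hence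
  the contributions add up, and their sum is bounded by the density at \<open>(N, 0)\<close>.

  The exterior algebra itself is not constructed. A nonzero alternating \<open>N\<close>-linear form \<open>D\<close>
  identifies the dual of \<open>\<Lambda>\<^sup>a(V/\<langle>S\<rangle>)\<close> with the multivectors of degree \<open>N - a\<close> divisible by the
  wedge of \<open>S\<close>, and \<open>rk a S\<close> is the rank of the matrix of values \<open>D (z @ M)\<close>, where \<open>z\<close> runs
  through lists that represent elements of the ideal and \<open>M\<close> through lists of vectors of \<open>E\<close> that
  contain \<open>S\<close>.
\<close>

section \<open>Dimension and general position\<close>

text \<open>
  The rank arguments below take place in spaces of functions on an infinite set. The dimension
  facts are therefore stated for finite sets in an arbitrary vector space.
\<close>
context vector_space
begin

lemma dim_insert_if_notin_span:
  assumes "finite S" "x \<notin> span S"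
  shows "dim (insert x S) = Suc (dim S)"
proof -
  obtain B where B: "B \<subseteq> S" "independent B" "S \<subseteq> span B" "card B = dim S"
    using basis_exists by blast
  have fB: "finite B" using B(1) assms(1) finite_subset by blast
  have eq: "span B = span S"
    by (metis B(1,3) span_eq span_superset subset_trans)
  have xB: "x \<notin> span B" using assms(2) eq by simp
  have "dim (insert x S) = card (insert x B)"
  proof (rule dim_unique)
    show "insert x S \<subseteq> span (insert x B)"
      using B(3) span_mono[of B "insert x B"] span_base[of x "insert x B"] by blast
    show "independent (insert x B)" using xB B(2) by (rule independent_insertI)
  qed (use B in auto)
  also have "x \<notin> B" using xB span_base by blast
  then have "card (insert x B) = Suc (dim S)" using fB B(4) by simp
  finally show ?thesis .
qed

lemma dim_insert_if_in_span:
  assumes "x \<in> span S"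
  shows "dim (insert x S) = dim S"
proof -
  have "span (insert x S) = span S" using assms by (rule span_redundant)
  then show ?thesis by (metis dim_span)
qed

lemma dim_le_if_finite_spanning:
  assumes "V \<subseteq> span W" "finite W"
  shows "dim V \<le> dim W"
proof -
  obtain B where B: "B \<subseteq> W" "independent B" "W \<subseteq> span B" "card B = dim W"
    using basis_exists by blast
  have "V \<subseteq> span B" using assms(1) B(3) span_minimal subspace_span by blast
  then have "dim V \<le> card B"
    by (rule dim_le_card) (use B(1) assms(2) finite_subset in blast)
  then show ?thesis using B by simp
qed

lemma card_le_dim_if_independent:
  assumes "independent I" "I \<subseteq> span W" "finite W"
  shows "finite I" "card I \<le> dim W"
proof -
  show "finite I" using independent_span_bound assms by blast
  show "card I \<le> dim W"
    using dim_le_if_finite_spanning[OF assms(2,3)] dim_eq_card_independent[OF assms(1)] by simp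
qed

lemma dim_Un_finite_le:
  assumes "finite F" "finite W"
  shows "dim (W \<union> F) \<le> dim W + card F"
  using assms
proof (induction F rule: finite_induct)
  case (insert x F)
  have "dim (insert x (W \<union> F)) \<le> Suc (dim (W \<union> F))"
    using insert dim_insert_if_in_span[of x "W \<union> F"] dim_insert_if_notin_span[of "W \<union> F" x]
    by (cases "x \<in> span (W \<union> F)") auto
  then show ?case using insert by simp
qed simp

text \<open>
  A form of rank-nullity that compares spans of given finite sets. Adding a generator \<open>x\<close> of \<open>G\<close>
  to \<open>K\<close> raises the dimension whenever it raises that of the image, because \<open>\<phi>\<close> vanishes on \<open>K\<close>.
\<close>
lemma dim_linear_image_plus_kernel_le:
  assumes lin: "Vector_Spaces.linear scale scale \<phi>"
    and G: "finite G" and K: "finite K" "K \<subseteq> span G" "\<And>x. x \<in> K \<Longrightarrow> \<phi> x = 0"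
    and H: "H \<subseteq> span (\<phi> ` G)"
  shows "dim K + dim H \<le> dim G"
proof -
  interpret \<phi>: Vector_Spaces.linear scale scale \<phi> by fact
  have image: "\<phi> y \<in> span (\<phi> ` F)" if "y \<in> span (F \<union> K)" for y F
  proof -
    have "\<phi> ` span (F \<union> K) = span (\<phi> ` (F \<union> K))" by (rule \<phi>.span_image[symmetric])
    also have "\<dots> \<subseteq> span (\<phi> ` F)"
      using K(3) by (intro span_minimal) (auto intro: span_base span_zero)
    finally show ?thesis using that by blast
  qed
  have "dim K + dim (\<phi> ` F) \<le> dim (F \<union> K)" if "finite F" for F
    using that
  proof (induction F rule: finite_induct)
    case empty
    have "dim ({} :: 'b set) = 0" using dim_eq_card_independent[OF independent_empty] by simp
    then show ?case by simp
  next
    case (insert x F)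
    show ?case
    proof (cases "\<phi> x \<in> span (\<phi> ` F)")
      case True
      have "dim (F \<union> K) \<le> dim (insert x F \<union> K)"
        using insert K(1) by (intro dim_le_if_finite_spanning) (auto intro: span_base)
      then show ?thesis using insert dim_insert_if_in_span[OF True] by simp
    next
      case False
      then have "x \<notin> span (F \<union> K)" using image by blast
      then have "dim (insert x (F \<union> K)) = Suc (dim (F \<union> K))"
        using insert K(1) by (intro dim_insert_if_notin_span) auto
      moreover have "dim (insert (\<phi> x) (\<phi> ` F)) = Suc (dim (\<phi> ` F))"
        using insert False by (intro dim_insert_if_notin_span) auto
      ultimately show ?thesis using insert by simp
    qed
  qed
  from this[OF G] have "dim K + dim (\<phi> ` G) \<le> dim (G \<union> K)" .
  also have "\<dots> \<le> dim G"
    using K G by (intro dim_le_if_finite_spanning) (auto intro: span_base)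
  finally show ?thesis using dim_le_if_finite_spanning[OF H] G by simp
qed

lemma finite_if_at_most_one: "(\<And>s t. s \<in> X \<Longrightarrow> t \<in> X \<Longrightarrow> s = t) \<Longrightarrow> finite X"
  by (metis finite.simps insertI1 is_singletonI' is_singleton_def)

text \<open>
  A vector \<open>v\<close> outside all previous subspaces may lie in the new one, \<open>W\<close>. Then a line
  \<open>u + t v\<close> with \<open>u \<notin> W\<close> misses \<open>W\<close> and meets each of the others at most once, so an infinite field
  leaves a good \<open>t\<close>.
\<close>
lemma exists_notin_finite_Union_subspaces:
  assumes inf: "infinite (UNIV :: 'a set)" and fin: "finite F"
    and F: "\<And>W. W \<in> F \<Longrightarrow> subspace W" "\<And>W. W \<in> F \<Longrightarrow> W \<noteq> UNIV"
  shows "\<exists>v. \<forall>W\<in>F. v \<notin> W"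
  using fin F
proof (induction F rule: finite_induct)
  case (insert W F)
  then obtain v where v: "\<And>U. U \<in> F \<Longrightarrow> v \<notin> U" by auto
  show ?case
  proof (cases "v \<in> W")
    case False
    then show ?thesis using v by auto
  next
    case True
    from insert obtain u where u: "u \<notin> W" by blast
    define bad where "bad U = {t. u + scale t v \<in> U}" for U
    have fin_bad: "finite (bad U)" if U: "U \<in> F" for U
    proof -
      have sU: "subspace U" using insert U by simp
      have "t = t'" if "t \<in> bad U" "t' \<in> bad U" for t t'
      proof (rule ccontr)
        assume ne: "t \<noteq> t'"
        have "(u + scale t v) - (u + scale t' v) \<in> U"
          using that unfolding bad_def by (intro subspace_diff[OF sU]) auto
        then have "scale (t - t') v \<in> U" by (simp add: algebra_simps)
        then have "scale (inverse (t - t')) (scale (t - t') v) \<in> U"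
          by (rule subspace_scale[OF sU])
        then show False using v[OF U] ne by simp
      qed
      then show ?thesis by (intro finite_if_at_most_one) blast
    qed
    then have "finite (\<Union>U\<in>F. bad U)" using insert by blast
    then obtain t where t: "t \<notin> (\<Union>U\<in>F. bad U)" using inf by (metis UNIV_eq_I)
    have "u + scale t v \<notin> W"
    proof
      assume "u + scale t v \<in> W"
      moreover have "scale t v \<in> W" using True insert by (simp add: subspace_scale)
      ultimately have "(u + scale t v) - scale t v \<in> W"
        using insert by (intro subspace_diff) auto
      then show False using u by simp
    qed
    moreover have "\<forall>U\<in>F. u + scale t v \<notin> U" using t by (auto simp: bad_def)
    ultimately show ?thesis by blast
  qed
qed simp

end

context finite_dimensional_vector_space
begin

text \<open>
  The vectors are chosen one at a time. A new vector has to avoid the proper subspaces spanned by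
  some \<open>U\<close> together with a set of earlier vectors, and these are finitely many.
\<close>
lemma exists_generic_basis:
  assumes inf: "infinite (UNIV :: 'a set)" and fin: "finite \<U>"
  shows "\<exists>E. finite E \<and> card E = dimension \<and> span E = UNIV \<and>
    (\<forall>U\<in>\<U>. \<forall>S\<subseteq>E. dim U + card S \<le> dimension \<longrightarrow> dim (U \<union> S) = dim U + card S)"
proof -
  \<comment> \<open>The empty set is added to the family so that the chosen vectors also become independent.\<close>
  let ?\<V> = "insert {} \<U>"
  have "\<exists>E. finite E \<and> card E = t \<and>
      (\<forall>U\<in>?\<V>. \<forall>S\<subseteq>E. dim U + card S \<le> dimension \<longrightarrow> dim (U \<union> S) = dim U + card S)"
    if "t \<le> dimension" for t
    using that
  proof (induction t)
    case 0
    then show ?case by (intro exI[of _ "{}"]) auto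
  next
    case (Suc t)
    then have "t \<le> dimension" by simp
    from Suc.IH[OF this] obtain E where E: "finite E" "card E = t"
      "\<And>U S. U \<in> ?\<V> \<Longrightarrow> S \<subseteq> E \<Longrightarrow> dim U + card S \<le> dimension
        \<Longrightarrow> dim (U \<union> S) = dim U + card S"
      by blast
    define F where "F = (\<lambda>(U, S). span (U \<union> S)) ` 
      {(U, S). U \<in> ?\<V> \<and> S \<subseteq> E \<and> dim U + card S < dimension}"
    have "finite F"
    proof -
      have "finite (?\<V> \<times> Pow E)" using E(1) fin by simp
      moreover have "{(U, S). U \<in> ?\<V> \<and> S \<subseteq> E \<and> dim U + card S < dimension} \<subseteq> ?\<V> \<times> Pow E"
        by blast
      ultimately show ?thesis unfolding F_def using finite_subset by (intro finite_imageI) auto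
    qed
    moreover have "W \<noteq> UNIV" if "W \<in> F" for W
    proof -
      from that obtain U S where "U \<in> ?\<V>" "S \<subseteq> E" "dim U + card S < dimension" "W = span (U \<union> S)"
        by (auto simp: F_def)
      then have "dim W < dimension" using E(3)[of U S] by simp
      then show ?thesis by (auto simp: dimension_def)
    qed
    moreover have "subspace W" if "W \<in> F" for W
      using that by (auto simp: F_def)
    ultimately obtain v where v: "\<And>W. W \<in> F \<Longrightarrow> v \<notin> W"
      using exists_notin_finite_Union_subspaces[OF inf, of F] by blast
    have vS: "v \<notin> span (U \<union> S)" if "U \<in> ?\<V>" "S \<subseteq> E" "dim U + card S < dimension" for U S
      using v[of "span (U \<union> S)"] that unfolding F_def by blast
    have vE: "v \<notin> E"
      using vS[of "{}" E] E(2) Suc.prems by (auto intro: span_base)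
    have "dim (U \<union> S) = dim U + card S"
      if U: "U \<in> ?\<V>" and S: "S \<subseteq> insert v E" and le: "dim U + card S \<le> dimension" for U S
    proof (cases "v \<in> S")
      case False
      then show ?thesis using E(3)[OF U _ le] S by blast
    next
      case True
      have S': "S - {v} \<subseteq> E" using S by blast
      have fS: "finite (S - {v})" using S' E(1) finite_subset by blast
      have c: "card S = Suc (card (S - {v}))"
        using True fS by (metis card_Suc_Diff1 finite_Diff2 finite.emptyI finite_insert)
      have "dim (insert v (U \<union> (S - {v}))) = dim (U \<union> (S - {v})) + 1"
        using vS[OF U S'] le c by (simp add: dim_insert)
      moreover have "insert v (U \<union> (S - {v})) = U \<union> S" using True by blast
      moreover have "dim (U \<union> (S - {v})) = dim U + card (S - {v})"
        using E(3)[OF U S'] le c by simp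
      ultimately show ?thesis using c by simp
    qed
    then show ?case using E(1,2) vE by (intro exI[of _ "insert v E"]) auto
  qed
  from this[OF order_refl] obtain E where E: "finite E" "card E = dimension"
    "\<And>U S. U \<in> ?\<V> \<Longrightarrow> S \<subseteq> E \<Longrightarrow> dim U + card S \<le> dimension
        \<Longrightarrow> dim (U \<union> S) = dim U + card S"
    by blast
  have "dim E = dimension" using E(3)[of "{}" E] E(2) by simp
  then have "span E = UNIV" by (simp add: dim_eq_full)
  then show ?thesis using E by (intro exI[of _ E]) auto
qed

lemma dim_Un_if_Int_trivial:
  assumes A: "subspace A" and B: "subspace B" and AB: "dim (A \<inter> B) = 0"
  shows "dim (A \<union> B) = dim A + dim B"
proof -
  obtain C where C: "C \<subseteq> B" "independent C" "B \<subseteq> span C" "card C = dim B"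
    using basis_exists by blast
  have fC: "finite C" using C(2) by (rule finiteI_independent)
  have sA: "span A = A" using A by simp
  have "dim (A \<union> F) = dim A + card F" if "finite F" "F \<subseteq> C" for F
    using that
  proof (induction F rule: finite_induct)
    case (insert y F)
    have "y \<notin> span (A \<union> F)"
    proof
      assume "y \<in> span (A \<union> F)"
      then obtain a f where af: "a \<in> A" "f \<in> span F" "y = a + f"
        using sA unfolding span_Un by auto
      have "f \<in> B" "y \<in> B"
        using af(2) insert(4) C(1) B span_minimal[of F B] by auto
      then have "a \<in> A \<inter> B" using af subspace_diff[OF B, of y f] by auto
      then have "a = 0" using AB by auto
      then have "y \<in> span F" using af by simp
      then have "y \<in> span (C - {y})"
        using insert span_mono[of F "C - {y}"] by auto
      then show False using C(2) insert(4) unfolding dependent_def by blast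
    qed
    then show ?case using insert by (simp add: dim_insert)
  qed simp
  from this[OF fC] have "dim (A \<union> C) = dim A + dim B" using C(4) by simp
  moreover have "span (A \<union> C) = span (A \<union> B)"
  proof
    show "span (A \<union> C) \<subseteq> span (A \<union> B)" using C(1) by (intro span_mono) blast
    have "B \<subseteq> span (A \<union> C)" using C(3) span_mono[of C "A \<union> C"] by blast
    then show "span (A \<union> B) \<subseteq> span (A \<union> C)"
      using span_superset[of "A \<union> C"] by (intro span_minimal) auto
  qed
  ultimately show ?thesis by (metis dim_span)
qed

lemma dim_Un_less_if_Int_nontrivial:
  assumes A: "subspace A" and B: "subspace B" and AB: "dim (A \<inter> B) > 0"
  shows "dim (A \<union> B) < dim A + dim B"
proof -
  obtain x where x: "x \<in> A" "x \<in> B" "x \<noteq> 0" using AB by (auto simp: zero_less_iff_neq_zero)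
  have ind: "independent {x}" using x by (simp add: independent_insert)
  obtain C where C: "{x} \<subseteq> C" "C \<subseteq> A" "independent C" "A \<subseteq> span C"
    using maximal_independent_subset_extend[of "{x}" A] ind x by auto
  obtain C' where C': "{x} \<subseteq> C'" "C' \<subseteq> B" "independent C'" "B \<subseteq> span C'"
    using maximal_independent_subset_extend[of "{x}" B] ind x by auto
  have fin: "finite C" "finite C'" using C C' finiteI_independent by auto
  have card: "card C = dim A" "card C' = dim B"
    using C C' basis_card_eq_dim by auto
  have "A \<union> B \<subseteq> span (C \<union> C')"
    using subset_trans[OF C(4) span_mono] subset_trans[OF C'(4) span_mono] by simp
  then have "dim (A \<union> B) \<le> card (C \<union> C')" using fin by (intro dim_le_card) auto
  also have "\<dots> < card C + card C'"
  proof -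
    have "card (C \<inter> C') > 0" using C C' fin by (auto simp: card_gt_0_iff)
    then show ?thesis using card_Un_Int[OF fin] by simp
  qed
  finally show ?thesis using card by simp
qed

end

section \<open>Alternating forms\<close>

text \<open>
  The form acts on lists, so that arguments can be concatenated like factors of a wedge product.
  The value \<open>0\<close> on lists of the wrong length spares side conditions on lengths.
\<close>
locale volume_form = finite_dimensional_vector_space scale Basis
  for scale :: "'a::field \<Rightarrow> 'b::ab_group_add \<Rightarrow> 'b" and Basis +
  fixes D :: "'b list \<Rightarrow> 'a"
  assumes D_add: "D (xs @ (u + v) # ys) = D (xs @ u # ys) + D (xs @ v # ys)"
    and D_scale: "D (xs @ scale c v # ys) = c * D (xs @ v # ys)"
    and D_repeat: "D (xs @ v # ys @ v # zs) = 0"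
    and D_length: "length L \<noteq> dimension \<Longrightarrow> D L = 0"
    and D_nonzero: "\<exists>L. D L \<noteq> 0"
begin

lemma D_not_distinct: "\<not> distinct L \<Longrightarrow> D L = 0"
  using not_distinct_decomp[of L] D_repeat by fastforce

lemma D_swap: "D (xs @ u # v # ys) = - D (xs @ v # u # ys)"
proof -
  have "0 = D (xs @ (u + v) # (u + v) # ys)"
    using D_repeat[of xs "u + v" "[]" ys] by simp
  also have "\<dots> = D (xs @ u # (u + v) # ys) + D (xs @ v # (u + v) # ys)"
    by (rule D_add)
  also have "\<dots> = D (xs @ u # u # ys) + D (xs @ u # v # ys)
      + (D (xs @ v # u # ys) + D (xs @ v # v # ys))"
    using D_add[of "xs @ [u]" u v ys] D_add[of "xs @ [v]" u v ys] by simp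
  also have "\<dots> = D (xs @ u # v # ys) + D (xs @ v # u # ys)"
    using D_repeat[of xs u "[]" ys] D_repeat[of xs v "[]" ys] by simp
  finally show ?thesis by (simp add: eq_neg_iff_add_eq_0)
qed

lemma D_move_past: "\<exists>c. \<forall>xs zs. D (xs @ v # ys @ zs) = c * D (xs @ ys @ v # zs)"
proof (induction ys)
  case (Cons y ys)
  then obtain c where c: "\<And>xs zs. D (xs @ v # ys @ zs) = c * D (xs @ ys @ v # zs)" by blast
  have "D (xs @ v # (y # ys) @ zs) = - c * D (xs @ (y # ys) @ v # zs)" for xs zs
    using c[of "xs @ [y]" zs] D_swap[of xs v y "ys @ zs"] by simp
  then show ?case by blast
qed (auto intro: exI[of _ 1])

lemma D_permute: "mset M = mset M' \<Longrightarrow> \<exists>c. \<forall>xs. D (xs @ M) = c * D (xs @ M')"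
proof (induction M arbitrary: M')
  case (Cons v M)
  then have "v \<in> set M'" by (metis list.set_intros(1) set_mset_mset)
  then obtain ys zs where M': "M' = ys @ v # zs" by (auto dest: split_list)
  have "mset M = mset (ys @ zs)" using Cons.prems M' by simp
  from Cons.IH[OF this] obtain c where c: "\<And>xs. D (xs @ M) = c * D (xs @ ys @ zs)" by blast
  obtain d where d: "\<And>xs zs. D (xs @ v # ys @ zs) = d * D (xs @ ys @ v # zs)"
    using D_move_past by blast
  have "D (xs @ v # M) = c * d * D (xs @ M')" for xs
    using c[of "xs @ [v]"] d[of xs zs] M' by simp
  then show ?case by blast
qed (auto intro: exI[of _ 1])

lemma subspace_D_zero: "subspace {v. D (xs @ v # ys) = 0}"
proof (rule subspaceI)
  have "D (xs @ 0 # ys) = 0" using D_scale[of xs 0 0 ys] by simp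
  then show "0 \<in> {v. D (xs @ v # ys) = 0}" by simp
qed (simp_all add: D_add D_scale)

lemma D_eq_0_if_entry_in_span:
  assumes "v \<in> span (set xs \<union> set ys)"
  shows "D (xs @ v # ys) = 0"
proof -
  have "u \<in> {v. D (xs @ v # ys) = 0}" if "u \<in> set xs \<union> set ys" for u
    using that by (intro CollectI D_not_distinct) auto
  then have "span (set xs \<union> set ys) \<subseteq> {v. D (xs @ v # ys) = 0}"
    by (intro span_minimal subspace_D_zero) blast
  then show ?thesis using assms by blast
qed

text \<open>
  This is how a common vector of \<open>A\<^sub>i\<close> and \<open>B\<^sub>j\<close> makes every product that contains both of their
  bases vanish.
\<close>
lemma D_eq_0_if_not_spanning:
  assumes "dim (set L) < dimension"
  shows "D L = 0"
proof (cases "distinct L \<and> length L = dimension")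
  case False
  then show ?thesis using D_not_distinct D_length by blast
next
  case True
  then have "card (set L) = dimension" by (simp add: distinct_card)
  then have "dependent (set L)" using assms dim_eq_card_independent[of "set L"] by auto
  then obtain v where v: "v \<in> set L" "v \<in> span (set L - {v})" unfolding dependent_def by blast
  then obtain xs ys where L: "L = xs @ v # ys" by (auto dest: split_list)
  then have "set L - {v} = set xs \<union> set ys" using True by auto
  then show ?thesis using v(2) L D_eq_0_if_entry_in_span by simp
qed

text \<open>
  If \<open>D\<close> vanished on the spanning list \<open>L\<close>, it would vanish on all lists with entries from \<open>L\<close>.
  Replacing entries by arbitrary vectors, one at a time, multilinearity would give \<open>D = 0\<close>.
\<close>
lemma D_neq_0_if_spanning:
  assumes "length L = dimension" "span (set L) = UNIV"
  shows "D L \<noteq> 0"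
proof
  assume zero: "D L = 0"
  have "dimension \<le> card (set L)" 
    using dim_eq_full[of "set L"] assms(2) dim_le_card[of "set L" "set L"] by (simp add: span_superset)
  then have dist: "distinct L"
    using assms(1) card_length[of L] by (intro card_distinct) simp
  have zero': "D M = 0" if "set M \<subseteq> set L" for M
  proof (cases "distinct M \<and> length M = dimension")
    case False
    then show ?thesis using D_not_distinct D_length by blast
  next
    case True
    then have "set M = set L"
      using that dist assms(1) by (intro card_subset_eq) (auto simp: distinct_card)
    then have "mset M = mset L" using True dist by (simp add: set_eq_iff_mset_eq_distinct)
    from D_permute[OF this] obtain c where "\<And>xs. D (xs @ M) = c * D (xs @ L)" by blast
    from this[of "[]"] show ?thesis using zero by simp
  qed
  have "D (xs @ ys) = 0" if "set ys \<subseteq> set L" for xs ys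
    using that
  proof (induction xs arbitrary: ys rule: rev_induct)
    case Nil
    then show ?case using zero' by simp
  next
    case (snoc x xs)
    have "set L \<subseteq> {v. D (xs @ v # ys) = 0}"
      using snoc.IH[of "_ # ys"] snoc.prems by auto
    then have "span (set L) \<subseteq> {v. D (xs @ v # ys) = 0}"
      by (intro span_minimal subspace_D_zero)
    then show ?case using assms(2) by auto
  qed
  from this[of "[]"] D_nonzero show False by auto
qed

end

context finite_dimensional_vector_space
begin

text \<open>
  The determinant of the coordinate matrix with respect to \<open>Basis\<close>. Linearity in the entry at
  position \<open>length xs\<close> is read off the Leibniz formula, in which \<open>rest\<close> collects the factors that
  do not involve this entry.
\<close>
lemma exists_volume_form: "\<exists>D. volume_form scale Basis D"
proof -
  obtain bs where bs: "set bs = Basis" "distinct bs"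
    using finite_Basis finite_distinct_list by blast
  have len: "length bs = dimension" using bs distinct_card[of bs] by (simp add: dimension_def)
  let ?n = dimension
  define c where "c v j = representation Basis v (bs ! j)" for v j
  have c_add: "c (u + v) j = c u j + c v j" and c_scale: "c (scale r v) j = r * c v j" for u v r j
    unfolding c_def by (simp_all add: representation_add representation_scale independent_Basis span_Basis)
  define M where "M L = mat ?n ?n (\<lambda>(i, j). c (L ! i) j)" for L
  define D where "D L = (if length L = ?n then det (M L) else 0)" for L
  have carrier: "M L \<in> carrier_mat ?n ?n" for L by (simp add: M_def)
  define rest where "rest xs ys p = signof p * (\<Prod>i\<in>{0..<?n} - {length xs}. c ((xs @ 0 # ys) ! i) (p i))"
    for xs ys :: "'b list" and p
  have expand: "D (xs @ v # ys) =
      (\<Sum>p | p permutes {0..<?n}. c v (p (length xs)) * rest xs ys p)"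
    if "length (xs @ v # ys) = ?n" for xs v ys
  proof -
    have "D (xs @ v # ys) = (\<Sum>p | p permutes {0..<?n}. signof p *
        (\<Prod>i = 0..<?n. M (xs @ v # ys) $$ (i, p i)))"
      using that det_def'[OF carrier] by (simp add: D_def)
    also have "\<dots> = (\<Sum>p | p permutes {0..<?n}. c v (p (length xs)) * rest xs ys p)"
    proof (rule sum.cong[OF refl])
      fix p assume "p \<in> {p. p permutes {0..<?n}}"
      then have p: "p i < ?n" if "i < ?n" for i
        using that permutes_in_image[of p "{0..<?n}" i] by auto
      have "(\<Prod>i = 0..<?n. M (xs @ v # ys) $$ (i, p i)) =
          (\<Prod>i = 0..<?n. c ((xs @ v # ys) ! i) (p i))"
        using p by (intro prod.cong) (auto simp: M_def)
      also have "\<dots> = c v (p (length xs)) *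
          (\<Prod>i\<in>{0..<?n} - {length xs}. c ((xs @ v # ys) ! i) (p i))"
        using that by (subst prod.remove[of _ "length xs"]) auto
      also have "(\<Prod>i\<in>{0..<?n} - {length xs}. c ((xs @ v # ys) ! i) (p i)) =
          (\<Prod>i\<in>{0..<?n} - {length xs}. c ((xs @ 0 # ys) ! i) (p i))"
        by (intro prod.cong) (auto simp: nth_append nth_Cons')
      finally show "signof p * (\<Prod>i = 0..<?n. M (xs @ v # ys) $$ (i, p i)) =
          c v (p (length xs)) * rest xs ys p"
        by (simp add: rest_def)
    qed
    finally show ?thesis .
  qed
  have "volume_form scale Basis D"
  proof
    show "D (xs @ (u + v) # ys) = D (xs @ u # ys) + D (xs @ v # ys)" for xs u v ys
    proof (cases "length (xs @ u # ys) = ?n")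
      case True
      then show ?thesis by (simp add: expand c_add distrib_right sum.distrib)
    qed (simp add: D_def)
    show "D (xs @ scale r v # ys) = r * D (xs @ v # ys)" for xs r v ys
    proof (cases "length (xs @ v # ys) = ?n")
      case True
      then show ?thesis by (simp add: expand c_scale sum_distrib_left mult.assoc)
    qed (simp add: D_def)
    show "D (xs @ v # ys @ v # zs) = 0" for xs v ys zs
    proof (cases "length (xs @ v # ys @ v # zs) = ?n")
      case True
      let ?L = "xs @ v # ys @ v # zs"
      let ?i = "length xs" and ?j = "Suc (length xs + length ys)"
      have "?L ! ?i = v" by simp
      moreover have "?L ! ?j = v" by (simp add: nth_append)
      ultimately have "row (M ?L) ?i = row (M ?L) ?j"
        using True by (intro eq_vecI) (simp_all add: M_def del: append.simps)
      then have "det (M ?L) = 0"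
        using True by (intro det_identical_rows[OF carrier, of ?i ?j]) auto
      then show ?thesis by (simp add: D_def)
    qed (simp add: D_def)
    show "D L = 0" if "length L \<noteq> dimension" for L using that by (simp add: D_def)
    have "M bs = 1\<^sub>m ?n"
    proof (rule eq_matI)
      fix i j assume "i < dim_row (1\<^sub>m ?n)" "j < dim_col (1\<^sub>m ?n)"
      then show "M bs $$ (i, j) = 1\<^sub>m ?n $$ (i, j)"
        using bs len nth_mem[of i bs]
        by (auto simp: M_def c_def representation_basis[OF independent_Basis] nth_eq_iff_index_eq)
    qed (auto simp: M_def)
    then have "D bs = 1" using len by (simp add: D_def)
    then show "\<exists>L. D L \<noteq> 0" by (intro exI[of _ bs]) simp
  qed
  then show ?thesis by blast
qed

end

section \<open>Ranks of right ideals modulo coordinate subspaces\<close>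
definition fun_scale :: "'a::field \<Rightarrow> ('i \<Rightarrow> 'a) \<Rightarrow> 'i \<Rightarrow> 'a"
  where "fun_scale c f = (\<lambda>x. c * f x)"

interpretation funs: vector_space fun_scale
  by standard (auto simp: fun_scale_def fun_eq_iff algebra_simps)

text \<open>
  Averaging over the sets of size \<open>s\<close> and then over a new element gives each set of size \<open>s + 1\<close>
  the same weight.
\<close>
lemma sum_insert_subsets:
  fixes f :: "'b set \<Rightarrow> nat"
  assumes "finite E"
  shows "(\<Sum>S | S \<subseteq> E \<and> card S = s. \<Sum>v\<in>E - S. f (insert v S)) =
    Suc s * (\<Sum>S | S \<subseteq> E \<and> card S = Suc s. f S)"
proof -
  let ?P = "\<lambda>s. {S. S \<subseteq> E \<and> card S = s}"
  have fin: "finite (?P s)" "finite S" if "S \<subseteq> E" for s S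
    using assms that finite_subset by auto
  have "(\<Sum>S\<in>?P s. \<Sum>v\<in>E - S. f (insert v S)) = (\<Sum>(S, v)\<in>Sigma (?P s) (\<lambda>S. E - S). f (insert v S))"
    using assms by (intro sum.Sigma) auto
  also have "\<dots> = (\<Sum>(S, v)\<in>Sigma (?P (Suc s)) (\<lambda>S. S). f S)"
    by (rule sum.reindex_bij_witness[of _ "\<lambda>(S, v). (S - {v}, v)" "\<lambda>(S, v). (insert v S, v)"])
      (use fin in \<open>auto simp: insert_absorb card_Diff_singleton\<close>)
  also have "\<dots> = (\<Sum>S\<in>?P (Suc s). \<Sum>v\<in>S. f S)"
    using assms fin by (intro sum.Sigma[symmetric]) auto
  also have "\<dots> = Suc s * (\<Sum>S\<in>?P (Suc s). f S)"
    by (simp add: sum_distrib_left)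
  finally show ?thesis .
qed

locale volume_form_with_frame = volume_form scale Basis D
  for scale :: "'a::field \<Rightarrow> 'b::ab_group_add \<Rightarrow> 'b" and Basis D +
  fixes E :: "'b set"
  assumes finite_E: "finite E" and card_E: "card E = dimension" and span_E: "span E = UNIV"
begin

text \<open>
  A set \<open>Z\<close> of lists stands for a set of decomposable multivectors, and closure of \<open>Z\<close> under
  appending vectors makes its span a right ideal. The multivector \<open>M\<close> acts on it as the functional
  \<open>pairing Z M\<close>.
\<close>
definition pairing :: "'b list set \<Rightarrow> 'b list \<Rightarrow> 'b list \<Rightarrow> 'a"
  where "pairing Z M = (\<lambda>z. if z \<in> Z then D (z @ M) else 0)"

text \<open>
  Functionals of degree \<open>N - a\<close> divisible by the wedge of \<open>S\<close> are those that factor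
  through \<open>\<Lambda>\<^sup>a(V/\<langle>S\<rangle>)\<close>.
\<close>
definition cogenerators :: "nat \<Rightarrow> 'b set \<Rightarrow> 'b list set"
  where "cogenerators a S = {M. set M \<subseteq> E \<and> S \<subseteq> set M \<and> length M + a = dimension}"

text \<open>
  Row rank equals column rank, so this is the dimension of the image of the degree-\<open>a\<close> part of
  the ideal in \<open>\<Lambda>\<^sup>a(V/\<langle>S\<rangle>)\<close>.
\<close>
definition rk :: "'b list set \<Rightarrow> nat \<Rightarrow> 'b set \<Rightarrow> nat"
  where "rk Z a S = funs.dim (pairing Z ` cogenerators a S)"

lemma finite_cogenerators: "finite (cogenerators a S)"
proof (rule finite_subset)
  show "cogenerators a S \<subseteq> {M. set M \<subseteq> E \<and> length M = dimension - a}"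
    by (auto simp: cogenerators_def)
qed (use finite_E finite_lists_length_eq in blast)

lemma pairing_not_distinct: "\<not> distinct M \<Longrightarrow> pairing Z M = 0"
  by (auto simp: pairing_def fun_eq_iff D_not_distinct)

text \<open>
  Take a basis \<open>I\<close> of the functionals modulo \<open>S\<close> that consists of pairings with lists over \<open>E\<close>. Each
  of these lists has exactly \<open>b\<close> entries outside \<open>S\<close>, and its pairing remains available modulo
  \<open>insert v S\<close> when \<open>v\<close> is one of them. Double counting the incidences between \<open>I\<close> and \<open>E - S\<close>
  gives the bound.
\<close>
lemma rk_insert_lower_bound:
  assumes "S \<subseteq> E" "card S + (a + b) = dimension"
  shows "b * rk Z a S \<le> (\<Sum>v\<in>E - S. rk Z a (insert v S))"
proof -
  let ?G = "pairing Z ` cogenerators a S"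
  obtain I where I: "I \<subseteq> ?G" "funs.independent I" "?G \<subseteq> funs.span I" "card I = funs.dim ?G"
    using funs.basis_exists by blast
  have fI: "finite I" using I(1) finite_cogenerators finite_subset by blast
  have "\<forall>f\<in>I. \<exists>M. M \<in> cogenerators a S \<and> f = pairing Z M" using I(1) by blast
  then obtain M where M: "\<And>f. f \<in> I \<Longrightarrow> M f \<in> cogenerators a S" "\<And>f. f \<in> I \<Longrightarrow> f = pairing Z (M f)"
    by metis
  have card: "card (set (M f) - S) = b" if "f \<in> I" for f
  proof -
    have "f \<noteq> 0" using I(2) that funs.dependent_zero by blast
    then have "distinct (M f)" using M(2)[OF that] pairing_not_distinct by metis
    then have "card (set (M f)) + a = dimension"
      using M(1)[OF that] by (simp add: cogenerators_def distinct_card)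
    moreover have "card (set (M f) - S) = card (set (M f)) - card S"
      using M(1)[OF that] by (intro card_Diff_subset) (auto simp: cogenerators_def intro: finite_subset)
    ultimately show ?thesis using assms(2) by simp
  qed
  have le: "card {f \<in> I. v \<in> set (M f)} \<le> rk Z a (insert v S)" for v
    unfolding rk_def
  proof (rule funs.card_le_dim_if_independent(2))
    show "funs.independent {f \<in> I. v \<in> set (M f)}"
      using I(2) by (rule funs.independent_mono) blast
    have "f \<in> pairing Z ` cogenerators a (insert v S)" if "f \<in> I" "v \<in> set (M f)" for f
      using M[OF that(1)] that(2) by (intro image_eqI[of _ _ "M f"]) (auto simp: cogenerators_def)
    then show "{f \<in> I. v \<in> set (M f)} \<subseteq> funs.span (pairing Z ` cogenerators a (insert v S))"
      using funs.span_base by blast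
  qed (simp add: finite_cogenerators)
  have "b * rk Z a S = (\<Sum>f\<in>I. card (set (M f) - S))"
    using card I(4) by (simp add: rk_def)
  also have "\<dots> = (\<Sum>f\<in>I. \<Sum>v\<in>E - S. if v \<in> set (M f) then 1 else 0)"
  proof (rule sum.cong[OF refl])
    fix f assume "f \<in> I"
    then have "set (M f) - S = {v \<in> E - S. v \<in> set (M f)}"
      using M(1) by (auto simp: cogenerators_def)
    then show "card (set (M f) - S) = (\<Sum>v\<in>E - S. if v \<in> set (M f) then 1 else 0)"
      using finite_E by (simp add: sum.If_cases Int_def)
  qed
  also have "\<dots> = (\<Sum>v\<in>E - S. \<Sum>f\<in>I. if v \<in> set (M f) then 1 else 0)"
    by (rule sum.swap)
  also have "\<dots> = (\<Sum>v\<in>E - S. card {f \<in> I. v \<in> set (M f)})"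
    using fI by (simp add: sum.If_cases Int_def)
  also have "\<dots> \<le> (\<Sum>v\<in>E - S. rk Z a (insert v S))"
    by (intro sum_mono le)
  finally show ?thesis .
qed

text \<open>
  Wedging an ideal element of degree \<open>a\<close> with \<open>v\<close> gives one of degree \<open>a + 1\<close>. The dual map \<open>\<phi>\<close>
  kills every functional divisible by \<open>v\<close>, and these span a space of dimension
  \<open>rk Z (Suc a) (insert v S)\<close>. Its image contains all functionals of degree \<open>N - a\<close>
  divisible by \<open>v\<close> and \<open>S\<close>: move \<open>v\<close> to the front of such a product and strip it off.
\<close>
lemma rk_insert_add_le:
  assumes Z: "\<And>z v. z \<in> Z \<Longrightarrow> z @ [v] \<in> Z" and v: "v \<in> E - S"
  shows "rk Z (Suc a) (insert v S) + rk Z a (insert v S) \<le> rk Z (Suc a) S"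
  unfolding rk_def
proof (rule funs.dim_linear_image_plus_kernel_le)
  define \<phi> :: "('b list \<Rightarrow> 'a) \<Rightarrow> 'b list \<Rightarrow> 'a" where "\<phi> f = (\<lambda>z. if z \<in> Z then f (z @ [v]) else 0)" for f
  show "Vector_Spaces.linear fun_scale fun_scale \<phi>"
    by unfold_locales (auto simp: \<phi>_def fun_scale_def fun_eq_iff)
  have \<phi>_pairing: "\<phi> (pairing Z M) = pairing Z (v # M)" for M
    using Z by (auto simp: \<phi>_def pairing_def fun_eq_iff)
  let ?G = "pairing Z ` cogenerators (Suc a) S"
  let ?K = "pairing Z ` cogenerators (Suc a) (insert v S)"
  let ?H = "pairing Z ` cogenerators a (insert v S)"
  show "finite ?G" "finite ?K" by (simp_all add: finite_cogenerators)
  show "?K \<subseteq> funs.span ?G"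
    by (rule subset_trans[OF _ funs.span_superset]) (auto simp: cogenerators_def)
  show "\<phi> f = 0" if "f \<in> ?K" for f
    using that by (auto simp: \<phi>_pairing cogenerators_def intro!: pairing_not_distinct)
  have "pairing Z M \<in> funs.span (\<phi> ` ?G)" if M: "M \<in> cogenerators a (insert v S)" for M
  proof -
    obtain xs ys where xy: "M = xs @ v # ys"
      using M by (auto simp: cogenerators_def dest: split_list)
    then have "mset M = mset (v # xs @ ys)" by simp
    from D_permute[OF this] obtain c where "\<And>z. D (z @ M) = c * D (z @ v # xs @ ys)" by blast
    then have "pairing Z M = fun_scale c (pairing Z (v # xs @ ys))"
      by (auto simp: pairing_def fun_scale_def fun_eq_iff)
    also have "\<dots> = fun_scale c (\<phi> (pairing Z (xs @ ys)))" by (simp only: \<phi>_pairing)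
    finally have "pairing Z M = fun_scale c (\<phi> (pairing Z (xs @ ys)))" .
    moreover have "xs @ ys \<in> cogenerators (Suc a) S"
      using M v xy by (auto simp: cogenerators_def)
    ultimately show ?thesis
      by (simp only:) (intro funs.span_scale funs.span_base imageI)
  qed
  then show "?H \<subseteq> funs.span (\<phi> ` ?G)" by blast
qed

text \<open>
  Sum the previous inequality over all \<open>a + 1 + b\<close> elements of \<open>E - S\<close>, and use the lower bound to
  remove \<open>b\<close> of these copies of \<open>rk Z (Suc a) S\<close>.
\<close>
lemma rk_insert_upper_bound:
  assumes Z: "\<And>z v. z \<in> Z \<Longrightarrow> z @ [v] \<in> Z"
    and S: "S \<subseteq> E" "card S + (Suc a + b) = dimension"
  shows "(\<Sum>v\<in>E - S. rk Z a (insert v S)) \<le> Suc a * rk Z (Suc a) S"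
proof -
  have "card (E - S) = Suc a + b"
    using S finite_E card_E by (simp add: card_Diff_subset finite_subset)
  moreover have "(\<Sum>v\<in>E - S. rk Z (Suc a) (insert v S)) + (\<Sum>v\<in>E - S. rk Z a (insert v S))
      \<le> card (E - S) * rk Z (Suc a) S"
    unfolding sum.distrib[symmetric]
    using sum_bounded_above[of "E - S" _ "rk Z (Suc a) S"] rk_insert_add_le[OF Z] by simp
  moreover have "b * rk Z (Suc a) S \<le> (\<Sum>v\<in>E - S. rk Z (Suc a) (insert v S))"
    using S by (rule rk_insert_lower_bound)
  ultimately show ?thesis by (simp add: algebra_simps)
qed

text \<open>
  Functionals given by arbitrary vectors, such as a basis of \<open>B\<^sub>k\<close>, reduce to those given by
  vectors of \<open>E\<close> by multilinear expansion.
\<close>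
lemma pairing_append_in_span:
  assumes "set M \<subseteq> E" "length L + length M + a = dimension"
  shows "pairing Z (L @ M) \<in> funs.span (pairing Z ` cogenerators a (set M))"
  using assms
proof (induction L arbitrary: M rule: rev_induct)
  case Nil
  then show ?case by (auto simp: cogenerators_def intro!: funs.span_base)
next
  case (snoc x L)
  let ?U = "funs.span (pairing Z ` cogenerators a (set M))"
  let ?X = "{x. pairing Z (L @ x # M) \<in> ?U}"
  have "subspace ?X"
  proof (rule subspaceI)
    have "pairing Z (L @ 0 # M) = 0"
      using D_scale[of _ 0 0 M] by (auto simp: pairing_def fun_eq_iff simp flip: append_assoc)
    then show "0 \<in> ?X" by (simp add: funs.span_zero)
    have "pairing Z (L @ (x + y) # M) = pairing Z (L @ x # M) + pairing Z (L @ y # M)" for x y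
      using D_add by (auto simp: pairing_def fun_eq_iff simp flip: append_assoc)
    then show "x + y \<in> ?X" if "x \<in> ?X" "y \<in> ?X" for x y
      using that by (simp add: funs.span_add)
    have "pairing Z (L @ scale c x # M) = fun_scale c (pairing Z (L @ x # M))" for c x
      using D_scale by (auto simp: pairing_def fun_scale_def fun_eq_iff simp flip: append_assoc)
    then show "scale c x \<in> ?X" if "x \<in> ?X" for c x
      using that by (simp add: funs.span_scale)
  qed
  moreover have "e \<in> ?X" if "e \<in> E" for e
  proof -
    have "pairing Z (L @ e # M) \<in> funs.span (pairing Z ` cogenerators a (set (e # M)))"
      using snoc.prems that by (intro snoc.IH) auto
    also have "\<dots> \<subseteq> ?U" by (intro funs.span_mono image_mono) (auto simp: cogenerators_def)
    finally show ?thesis by simp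
  qed
  ultimately have "span E \<subseteq> ?X" by (intro span_minimal) auto
  then show ?case using span_E by auto
qed

text \<open>
  Restriction from \<open>Z'\<close> to \<open>Z\<close> maps the functionals on the larger ideal onto those on the smaller
  one, and the functional given by \<open>L\<close> and \<open>S\<close> is a nonzero element of its kernel.
\<close>
lemma rk_strict_mono:
  assumes Z: "Z \<subseteq> Z'" and S: "S \<subseteq> E" and L: "length L + card S + a = dimension"
    and zero: "\<And>z M. z \<in> Z \<Longrightarrow> set M = S \<Longrightarrow> D (z @ L @ M) = 0"
    and nonzero: "\<And>M. set M = S \<Longrightarrow> distinct M \<Longrightarrow> \<exists>z\<in>Z'. D (z @ L @ M) \<noteq> 0"
  shows "rk Z a S + 1 \<le> rk Z' a S"
proof -
  define \<phi> :: "('b list \<Rightarrow> 'a) \<Rightarrow> 'b list \<Rightarrow> 'a" where "\<phi> f = (\<lambda>z. if z \<in> Z then f z else 0)" for f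
  have \<phi>_pairing: "\<phi> (pairing Z' M) = pairing Z M" for M
    using Z by (auto simp: \<phi>_def pairing_def fun_eq_iff)
  obtain M where M: "set M = S" "distinct M"
    using S finite_E finite_subset finite_distinct_list by metis
  let ?k = "pairing Z' (L @ M)"
  have "?k \<noteq> 0" using nonzero[OF M] by (auto simp: pairing_def fun_eq_iff)
  then have "funs.independent {?k}" by (simp add: funs.independent_insert)
  then have "funs.dim {?k} = 1" using funs.dim_eq_card_independent[of "{?k}"] by simp
  moreover have "funs.dim {?k} + rk Z a S \<le> rk Z' a S"
    unfolding rk_def
  proof (rule funs.dim_linear_image_plus_kernel_le)
    show "Vector_Spaces.linear fun_scale fun_scale \<phi>"
      by unfold_locales (auto simp: \<phi>_def fun_scale_def fun_eq_iff)
    show "{?k} \<subseteq> funs.span (pairing Z' ` cogenerators a S)"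
      using pairing_append_in_span[of M L a Z'] M S L distinct_card[OF M(2)] by simp
    show "\<phi> f = 0" if "f \<in> {?k}" for f
      using that zero M by (auto simp: \<phi>_pairing) (auto simp: pairing_def fun_eq_iff)
    show "pairing Z ` cogenerators a S \<subseteq> funs.span (\<phi> ` pairing Z' ` cogenerators a S)"
      by (simp add: image_image \<phi>_pairing funs.span_superset)
  qed (simp_all add: finite_cogenerators)
  ultimately show ?thesis by simp
qed

section \<open>Densities\<close>
definition rk_sum :: "'b list set \<Rightarrow> nat \<Rightarrow> nat \<Rightarrow> nat"
  where "rk_sum Z a b = (\<Sum>S | S \<subseteq> E \<and> card S = dimension - (a + b). rk Z a S)"

text \<open>
  The factor is the reciprocal of \<open>(N choose (a + b)) * ((a + b) choose a)\<close>, where \<open>N\<close> is the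
  dimension. So this is the average of \<open>rk Z a S\<close>, relative to the dimension \<open>(a + b) choose a\<close>
  of \<open>\<Lambda>\<^sup>a(V/\<langle>S\<rangle>)\<close>.
\<close>
definition density :: "'b list set \<Rightarrow> nat \<Rightarrow> nat \<Rightarrow> real"
  where "density Z a b = real (rk_sum Z a b) * (fact a * fact b * fact (dimension - (a + b)) / fact dimension)"

lemma density_nonneg: "0 \<le> density Z a b"
  by (simp add: density_def)

lemma density_decr_snd:
  assumes "a + Suc b \<le> dimension"
  shows "density Z a (Suc b) \<le> density Z a b"
proof -
  define s where "s = dimension - (a + Suc b)"
  have s: "dimension - (a + b) = Suc s" "dimension - (a + Suc b) = s" using assms by (auto simp: s_def)
  have "Suc b * rk_sum Z a (Suc b) = (\<Sum>S | S \<subseteq> E \<and> card S = s. Suc b * rk Z a S)"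
    unfolding rk_sum_def s by (rule sum_distrib_left)
  also have "\<dots> \<le> (\<Sum>S | S \<subseteq> E \<and> card S = s. \<Sum>v\<in>E - S. rk Z a (insert v S))"
    using assms by (intro sum_mono rk_insert_lower_bound) (auto simp: s_def)
  also have "\<dots> = Suc s * rk_sum Z a b"
    by (simp add: rk_sum_def s sum_insert_subsets[OF finite_E] del: mult_Suc)
  finally have "real (Suc b * rk_sum Z a (Suc b)) \<le> real (Suc s * rk_sum Z a b)"
    by (simp only: of_nat_le_iff)
  then have "real (Suc b * rk_sum Z a (Suc b)) * (fact a * fact b * fact s / fact dimension)
      \<le> real (Suc s * rk_sum Z a b) * (fact a * fact b * fact s / fact dimension)"
    by (rule mult_right_mono) simp
  then show ?thesis
    unfolding density_def s fact_Suc of_nat_mult by (simp add: mult_ac del: of_nat_Suc)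
qed

lemma density_incr_fst:
  assumes Z: "\<And>z v. z \<in> Z \<Longrightarrow> z @ [v] \<in> Z" and "Suc a + b \<le> dimension"
  shows "density Z a b \<le> density Z (Suc a) b"
proof -
  define s where "s = dimension - (Suc a + b)"
  have s: "dimension - (a + b) = Suc s" "dimension - (Suc a + b) = s" using assms by (auto simp: s_def)
  have "Suc s * rk_sum Z a b = (\<Sum>S | S \<subseteq> E \<and> card S = s. \<Sum>v\<in>E - S. rk Z a (insert v S))"
    by (simp add: rk_sum_def s sum_insert_subsets[OF finite_E] del: mult_Suc)
  also have "\<dots> \<le> (\<Sum>S | S \<subseteq> E \<and> card S = s. Suc a * rk Z (Suc a) S)"
    using assms by (intro sum_mono rk_insert_upper_bound[where b = b]) (auto simp: s_def)
  also have "\<dots> = Suc a * rk_sum Z (Suc a) b"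
    unfolding rk_sum_def s by (simp add: sum_distrib_left del: mult_Suc)
  finally have "real (Suc s * rk_sum Z a b) \<le> real (Suc a * rk_sum Z (Suc a) b)"
    by (simp only: of_nat_le_iff)
  then have "real (Suc s * rk_sum Z a b) * (fact a * fact b * fact s / fact dimension)
      \<le> real (Suc a * rk_sum Z (Suc a) b) * (fact a * fact b * fact s / fact dimension)"
    by (rule mult_right_mono) simp
  then show ?thesis
    unfolding density_def s fact_Suc of_nat_mult by (simp add: mult_ac del: of_nat_Suc)
qed

text \<open>
  First \<open>b\<close> is lowered and then \<open>a\<close> is raised; in this order \<open>a + b\<close> stays at most the dimension
  throughout.
\<close>
lemma density_mono:
  assumes Z: "\<And>z v. z \<in> Z \<Longrightarrow> z @ [v] \<in> Z"
    and "a \<le> a'" "b' \<le> b" "a + b \<le> dimension" "a' + b' \<le> dimension"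
  shows "density Z a b \<le> density Z a' b'"
proof -
  have "density Z a (b' + d) \<le> density Z a b'" if "a + (b' + d) \<le> dimension" for d
    using that
  proof (induction d)
    case (Suc d)
    then show ?case using density_decr_snd[of a "b' + d" Z] by simp
  qed simp
  from this[of "b - b'"] have "density Z a b \<le> density Z a b'" using assms by simp
  also have "density Z a b' \<le> density Z (a + d) b'" if "a + d + b' \<le> dimension" for d
    using that
  proof (induction d)
    case (Suc d)
    then show ?case using density_incr_fst[OF Z, of "a + d" b'] by simp
  qed simp
  from this[of "a' - a"] have "density Z a b' \<le> density Z a' b'" using assms by simp
  finally show ?thesis .
qed

text \<open>
  At the end point only the empty list pairs with the ideal, whose image lies in the line \<open>\<Lambda>\<^sup>N V\<close>.
\<close>
lemma density_top_le_1: "density Z dimension 0 \<le> 1"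
proof -
  have "{S. S \<subseteq> E \<and> card S = 0} = {{}}" using finite_E finite_subset by fastforce
  then have "rk_sum Z dimension 0 = rk Z dimension {}" by (simp add: rk_sum_def)
  also have "\<dots> \<le> card (pairing Z ` cogenerators dimension {})"
    unfolding rk_def by (rule funs.dim_le_card) (auto simp: finite_cogenerators funs.span_superset)
  also have "cogenerators dimension {} = {[]}" by (auto simp: cogenerators_def)
  finally have "rk_sum Z dimension 0 \<le> 1" by simp
  then show ?thesis by (simp add: density_def)
qed

lemma density_increment:
  assumes ab: "a + b \<le> dimension"
    and step: "\<And>S. S \<subseteq> E \<Longrightarrow> card S + (a + b) = dimension \<Longrightarrow> rk Z a S + 1 \<le> rk Z' a S"
  shows "density Z a b + 1 / real ((a + b) choose a) \<le> density Z' a b"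
proof -
  let ?P = "{S. S \<subseteq> E \<and> card S = dimension - (a + b)}"
  let ?c = "fact a * fact b * fact (dimension - (a + b)) / fact dimension :: real"
  have "rk_sum Z a b + (dimension choose (a + b)) = (\<Sum>S\<in>?P. rk Z a S + 1)"
    unfolding rk_sum_def sum.distrib
    using n_subsets[OF finite_E] card_E ab by (simp add: binomial_symmetric[OF ab])
  also have "\<dots> \<le> rk_sum Z' a b"
    unfolding rk_sum_def using ab by (intro sum_mono step) auto
  finally have "real (rk_sum Z a b + (dimension choose (a + b))) * ?c \<le> real (rk_sum Z' a b) * ?c"
    by (intro mult_right_mono) (simp_all only: of_nat_le_iff, simp)
  moreover have "real (dimension choose (a + b)) * ?c = 1 / real ((a + b) choose a)"
    using binomial_fact[OF ab, where 'a = real] binomial_fact[of a "a + b", where 'a = real]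
    by simp
  ultimately show ?thesis unfolding density_def of_nat_add distrib_right by simp
qed

end

section \<open>The skew Bollobas inequality for subspaces\<close>

context finite_dimensional_vector_space
begin

lemma skew_Bollobas_subspaces:
  fixes A B :: "nat \<Rightarrow> 'b set" and m :: nat
  assumes inf: "infinite (UNIV :: 'a set)"
    and A: "\<And>i. i \<in> {1..m} \<Longrightarrow> subspace (A i)"
    and B: "\<And>i. i \<in> {1..m} \<Longrightarrow> subspace (B i)"
    and diagonal: "\<And>i. i \<in> {1..m} \<Longrightarrow> dim (A i \<inter> B i) = 0"
    and skew: "\<And>i j. 1 \<le> i \<Longrightarrow> i < j \<Longrightarrow> j \<le> m \<Longrightarrow> dim (A i \<inter> B j) > 0"
    and incr: "\<And>i j. 1 \<le> i \<Longrightarrow> i \<le> j \<Longrightarrow> j \<le> m \<Longrightarrow> dim (A i) \<le> dim (A j)"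
    and decr: "\<And>i j. 1 \<le> i \<Longrightarrow> i \<le> j \<Longrightarrow> j \<le> m \<Longrightarrow> dim (B i) \<ge> dim (B j)"
  shows "(\<Sum>i = 1..m. 1 / real ((dim (A i) + dim (B i)) choose dim (A i))) \<le> 1"
proof -
  obtain D where "volume_form scale Basis D" using exists_volume_form by blast
  then interpret volume_form scale Basis D .
  obtain E where E: "finite E" "card E = dimension" "span E = UNIV"
    "\<And>i S. i \<in> {1..m} \<Longrightarrow> S \<subseteq> E \<Longrightarrow> dim (A i \<union> B i) + card S \<le> dimension
      \<Longrightarrow> dim (A i \<union> B i \<union> S) = dim (A i \<union> B i) + card S"
    using exists_generic_basis[OF inf, of "(\<lambda>i. A i \<union> B i) ` {1..m}"] by auto
  interpret volume_form_with_frame scale Basis D E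
    using E by unfold_locales auto
  have "\<exists>bs. set bs \<subseteq> X \<and> X \<subseteq> span (set bs) \<and> length bs = dim X" for X
  proof -
    obtain C where C: "C \<subseteq> X" "independent C" "X \<subseteq> span C" "card C = dim X"
      using basis_exists by blast
    then obtain bs where "set bs = C" "distinct bs"
      using finiteI_independent finite_distinct_list by blast
    then show ?thesis using C distinct_card[of bs] by (intro exI[of _ bs]) simp
  qed
  then obtain \<beta> where \<beta>: "\<And>X. set (\<beta> X) \<subseteq> X" "\<And>X. X \<subseteq> span (set (\<beta> X))"
    "\<And>X. length (\<beta> X) = dim X" by metis
  have dim_AB: "dim (A i \<union> B i) = dim (A i) + dim (B i)" if "i \<in> {1..m}" for i
    using that A B diagonal by (intro dim_Un_if_Int_trivial) auto
  have AB_le: "dim (A i) + dim (B i) \<le> dimension" if "i \<in> {1..m}" for i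
    using dim_AB[OF that] dim_subset_UNIV by metis
  define Z where "Z k = {\<beta> (A i) @ L | i L. 1 \<le> i \<and> i \<le> k}" for k
  have Z_append: "z @ [v] \<in> Z k" if "z \<in> Z k" for z v k
    using that by (fastforce simp: Z_def)
  \<comment> \<open>Wedging with a basis of \<open>B (Suc k)\<close> separates the new generator from the old ideal.\<close>
  have step: "rk (Z k) (dim (A (Suc k))) S + 1 \<le> rk (Z (Suc k)) (dim (A (Suc k))) S"
    if k: "Suc k \<le> m" and S: "S \<subseteq> E" "card S + (dim (A (Suc k)) + dim (B (Suc k))) = dimension" for k S
  proof (rule rk_strict_mono[where L = "\<beta> (B (Suc k))"])
    show "Z k \<subseteq> Z (Suc k)" unfolding Z_def using le_SucI by blast
    show "length (\<beta> (B (Suc k))) + card S + dim (A (Suc k)) = dimension"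
      using S \<beta>(3) by simp
    show "D (z @ \<beta> (B (Suc k)) @ M) = 0" if z: "z \<in> Z k" and "set M = S" for z M
    proof (cases "length (z @ \<beta> (B (Suc k)) @ M) = dimension")
      case False
      then show ?thesis by (rule D_length)
    next
      case True
      obtain i L where i: "1 \<le> i" "i \<le> k" "z = \<beta> (A i) @ L" using z by (auto simp: Z_def)
      have "dim (set (\<beta> (A i)) \<union> set (\<beta> (B (Suc k)))) \<le> dim (A i \<union> B (Suc k))"
        using \<beta>(1) by (intro dim_subset Un_mono)
      also have "\<dots> < dim (A i) + dim (B (Suc k))"
        using i k A B skew by (intro dim_Un_less_if_Int_nontrivial) auto
      finally have "dim (set (\<beta> (A i)) \<union> set (\<beta> (B (Suc k)))) + (length L + length M) < dimension"
        using True i \<beta>(3) by simp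
      moreover have "dim (set (z @ \<beta> (B (Suc k)) @ M)) \<le>
          dim (set (\<beta> (A i)) \<union> set (\<beta> (B (Suc k)))) + card (set (L @ M))"
        using dim_Un_finite_le[of "set (L @ M)" "set (\<beta> (A i)) \<union> set (\<beta> (B (Suc k)))"] i
        by (simp add: Un_ac)
      moreover have "card (set (L @ M)) \<le> length L + length M"
        using card_length[of "L @ M"] by simp
      ultimately show ?thesis by (intro D_eq_0_if_not_spanning) linarith
    qed
    show "\<exists>z\<in>Z (Suc k). D (z @ \<beta> (B (Suc k)) @ M) \<noteq> 0" if M: "set M = S" "distinct M" for M
    proof
      show "\<beta> (A (Suc k)) \<in> Z (Suc k)" by (force simp: Z_def)
      let ?L = "\<beta> (A (Suc k)) @ \<beta> (B (Suc k)) @ M"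
      show "D ?L \<noteq> 0"
      proof (rule D_neq_0_if_spanning)
        show "length ?L = dimension" using S M \<beta>(3) distinct_card[of M] by simp
        have "X \<subseteq> span (set ?L)" if "set (\<beta> X) \<subseteq> set ?L" for X
          using \<beta>(2)[of X] span_mono[OF that] by blast
        then have "A (Suc k) \<union> B (Suc k) \<union> S \<subseteq> span (set ?L)"
          using M(1) by (auto intro: span_base)
        then have "dim (A (Suc k) \<union> B (Suc k) \<union> S) \<le> dim (set ?L)" by (rule dim_mono)
        moreover have "dim (A (Suc k) \<union> B (Suc k) \<union> S) = dimension"
          using E(4)[of "Suc k" S] dim_AB[of "Suc k"] k S by simp
        ultimately have "dim (set ?L) = dimension"
          using dim_subset_UNIV by (metis le_antisym)
        then show "span (set ?L) = UNIV" using dim_eq_full by blast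
      qed
    qed
  qed (use S in auto)
  \<comment> \<open>The bound is proved at every point that comes after \<open>(dim (A k), dim (B k))\<close> in the order in
    which the density grows, so that it can be used at the point of the next pair.\<close>
  have bound: "(\<Sum>i = 1..k. 1 / real ((dim (A i) + dim (B i)) choose dim (A i))) \<le> density (Z k) a b"
    if "k \<le> m" "\<And>i. i \<in> {1..k} \<Longrightarrow> dim (A i) \<le> a \<and> b \<le> dim (B i)" "a + b \<le> dimension" for k a b
    using that
  proof (induction k arbitrary: a b)
    case 0
    then show ?case by (simp add: density_nonneg)
  next
    case (Suc k)
    let ?a = "dim (A (Suc k))" and ?b = "dim (B (Suc k))"
    have le: "?a + ?b \<le> dimension" using AB_le Suc.prems by simp
    have "(\<Sum>i = 1..Suc k. 1 / real ((dim (A i) + dim (B i)) choose dim (A i))) =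
        (\<Sum>i = 1..k. 1 / real ((dim (A i) + dim (B i)) choose dim (A i))) + 1 / real ((?a + ?b) choose ?a)"
      by simp
    also have "\<dots> \<le> density (Z k) ?a ?b + 1 / real ((?a + ?b) choose ?a)"
      using Suc.prems(1) incr decr le by (intro add_right_mono Suc.IH) auto
    also have "\<dots> \<le> density (Z (Suc k)) ?a ?b"
      using le step Suc.prems(1) by (intro density_increment) auto
    also have "\<dots> \<le> density (Z (Suc k)) a b"
      using Suc.prems le Z_append by (intro density_mono) auto
    finally show ?case .
  qed
  have "(\<Sum>i = 1..m. 1 / real ((dim (A i) + dim (B i)) choose dim (A i))) \<le> density (Z m) dimension 0"
    using dim_subset_UNIV by (intro bound) auto
  also have "\<dots> \<le> 1" by (rule density_top_le_1)
  finally show ?thesis .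
qed

end

theorem theorem4p5:
  fixes A B :: "nat \<Rightarrow> 'v::real_vector set" and m :: nat
  assumes fin_dim: "\<exists>Basis. finite_dimensional_vector_space ((*\<^sub>R) :: real \<Rightarrow> 'v \<Rightarrow> 'v) Basis"
    and subspace_A: "\<And>i. i \<in> {1..m} \<Longrightarrow> subspace (A i)"
    and subspace_B: "\<And>i. i \<in> {1..m} \<Longrightarrow> subspace (B i)"
    and nontrivial_A: "\<And>i. i \<in> {1..m} \<Longrightarrow> A i \<noteq> {0}"
    and nontrivial_B: "\<And>i. i \<in> {1..m} \<Longrightarrow> B i \<noteq> {0}"
    and diagonal: "\<And>i. i \<in> {1..m} \<Longrightarrow> dim (A i \<inter> B i) = 0"
    and skew: "\<And>i j. 1 \<le> i \<Longrightarrow> i < j \<Longrightarrow> j \<le> m \<Longrightarrow> dim (A i \<inter> B j) > 0"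
    and dim_A_incr: "\<And>i j. 1 \<le> i \<Longrightarrow> i \<le> j \<Longrightarrow> j \<le> m \<Longrightarrow> dim (A i) \<le> dim (A j)"
    and dim_B_decr: "\<And>i j. 1 \<le> i \<Longrightarrow> i \<le> j \<Longrightarrow> j \<le> m \<Longrightarrow> dim (B i) \<ge> dim (B j)"
  shows "(\<Sum>i = 1..m. 1 / real ((dim (A i) + dim (B i)) choose dim (A i))) \<le> 1"
proof -
  obtain Basis where "finite_dimensional_vector_space ((*\<^sub>R) :: real \<Rightarrow> 'v \<Rightarrow> 'v) Basis"
    using fin_dim by blast
  then show ?thesis
    \<comment> \<open>The constants for real vector spaces are instances of those of the vector space locale.\<close>
    unfolding dim_raw_def
    by (rule finite_dimensional_vector_space.skew_Bollobas_subspaces)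
      (use assms infinite_UNIV_char_0 in \<open>simp_all add: dim_raw_def subspace_raw_def\<close>)
qed

end
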